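(* Let $R$ be a ring. The family of ideals of $R$ with the right Artin-Rees property satisfies $(P_2)$. Thus an ideal of $R$ maximal with respect to not having the right Artin-Rees property is prime. In particular, if $R$ satisfies the ascending chain condition on (two-sided) ideals, then $R$ is a right Artin-Rees ring if and only if every prime ideal of $R$ has the right Artin-Rees property.
   Context: Rings are associative and unital, not necessarily commutative; "ideal" means two-sided ideal. An ideal $I$ of $R$ has the right Artin-Rees property if, for every right ideal $K$ of $R$, there exists a positive integer $n$ such that $K\cap I^n\subseteq KI$. The ring $R$ is a right Artin-Rees ring if every ideal of $R$ has the right Artin-Rees property. A family $\mathcal{F}$ of ideals of $R$ satisfies $(P_2)$ if $R\in\mathcal{F}$, $\mathcal{F}$ is closed under products ($I,J\in\mathcal{F}\Rightarrow IJ\in\mathcal{F}$), and for any $J\in\mathcal{F}$ and any ideal $I$ of $R$, $I^2\subseteq J\subseteq I$ implies $I\in\mathcal{F}$. *)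

theory Defs
  imports "HOL-Algebra.Ideal_Product"
begin

locale right_ideal = additive_subgroup K R + ring R for K and R (structure) +
  assumes K_r_closed: "\<lbrakk>a \<in> K; x \<in> carrier R\<rbrakk> \<Longrightarrow> a \<otimes> x \<in> K"

text \<open>
  The library locale \<open>primeideal\<close> presupposes a commutative ring and is stated elementwise;
  in a noncommutative ring primeness is a condition on products of two-sided ideals.
\<close>

locale nc_prime_ideal = ideal P R for P and R (structure) +
  assumes P_proper: "P \<noteq> carrier R"
    and P_prime: "\<lbrakk>ideal I R; ideal J R; I \<cdot> J \<subseteq> P\<rbrakk> \<Longrightarrow> I \<subseteq> P \<or> J \<subseteq> P"

text \<open>
  The set \<open>ideal_prod R K I\<close> consists of the finite sums of products \<open>k \<otimes> i\<close>, so it is also the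
  usual product \<open>K I\<close> when \<open>K\<close> is only a right ideal. Powers of \<open>I\<close> are taken in the
  multiplicative monoid of ideals, whose unit is \<open>carrier R\<close>.
\<close>

definition right_artin_rees_property :: "('a, 'b) ring_scheme \<Rightarrow> 'a set \<Rightarrow> bool"
  where "right_artin_rees_property R I \<longleftrightarrow>
    (\<forall>K. right_ideal K R \<longrightarrow>
      (\<exists>n::nat. n > 0 \<and> K \<inter> (I [^]\<^bsub>ideals_set R\<^esub> n) \<subseteq> K \<cdot>\<^bsub>R\<^esub> I))"

definition right_artin_rees_ring :: "('a, 'b) ring_scheme \<Rightarrow> bool"
  where "right_artin_rees_ring R \<longleftrightarrow>
    ring R \<and> (\<forall>I. ideal I R \<longrightarrow> right_artin_rees_property R I)"

definition satisfies_P2 :: "('a, 'b) ring_scheme \<Rightarrow> 'a set set \<Rightarrow> bool"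
  where "satisfies_P2 R F \<longleftrightarrow>
    (\<forall>I\<in>F. ideal I R) \<and>
    carrier R \<in> F \<and>
    (\<forall>I\<in>F. \<forall>J\<in>F. I \<cdot>\<^bsub>R\<^esub> J \<in> F) \<and>
    (\<forall>J\<in>F. \<forall>I. ideal I R \<and> I \<cdot>\<^bsub>R\<^esub> I \<subseteq> J \<and> J \<subseteq> I \<longrightarrow> I \<in> F)"

text \<open>The locale \<open>noetherian_ring\<close> is phrased through finite generation instead of chains.\<close>

definition acc_on_ideals :: "('a, 'b) ring_scheme \<Rightarrow> bool"
  where "acc_on_ideals R \<longleftrightarrow>
    (\<forall>C :: nat \<Rightarrow> 'a set. (\<forall>n. ideal (C n) R) \<and> (\<forall>n. C n \<subseteq> C (Suc n)) \<longrightarrow>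
      (\<exists>N. \<forall>n\<ge>N. C n = C N))"

definition maximal_without_right_artin_rees :: "('a, 'b) ring_scheme \<Rightarrow> 'a set \<Rightarrow> bool"
  where "maximal_without_right_artin_rees R P \<longleftrightarrow>
    ideal P R \<and> \<not> right_artin_rees_property R P \<and>
    (\<forall>J. ideal J R \<and> P \<subset> J \<longrightarrow> right_artin_rees_property R J)"

end

theory Submission
  imports Defs
begin

text \<open>
  If \<open>K \<inter> I\<^sup>n \<subseteq> K I\<close> and, for the right ideal \<open>K I\<close>, \<open>K I \<inter> J\<^sup>m \<subseteq> (K I) J\<close>, then
  \<open>K \<inter> (I J)\<^sup>k \<subseteq> K (I J)\<close> for \<open>k = max n m\<close>; and if \<open>I\<^sup>2 \<subseteq> J \<subseteq> I\<close>, then \<open>I\<^bsup>2n\<^esup> \<subseteq> J\<^sup>n\<close>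
  passes the property from \<open>J\<close> to \<open>I\<close>. For any family with \<open>(P\<^sub>2)\<close>, an ideal \<open>P\<close> maximal
  outside the family is prime: if \<open>A B \<subseteq> P\<close> with \<open>A, B\<close> not inside \<open>P\<close>, the family contains
  \<open>(A + P) (B + P)\<close>, which lies between \<open>P\<^sup>2\<close> and \<open>P\<close>.
\<close>

section \<open>Products and powers\<close>

lemma ideal_prod_mono:
  assumes "I \<subseteq> I'" "J \<subseteq> J'"
  shows "I \<cdot>\<^bsub>R\<^esub> J \<subseteq> I' \<cdot>\<^bsub>R\<^esub> J'"
proof
  fix s assume "s \<in> I \<cdot>\<^bsub>R\<^esub> J"
  then show "s \<in> I' \<cdot>\<^bsub>R\<^esub> J'"
    using assms by induction (auto intro: ideal_prod.intros)
qed

lemma ideal_prod_least: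
  assumes "additive_subgroup P R"
    and "\<And>i j. \<lbrakk>i \<in> I; j \<in> J\<rbrakk> \<Longrightarrow> i \<otimes>\<^bsub>R\<^esub> j \<in> P"
  shows "I \<cdot>\<^bsub>R\<^esub> J \<subseteq> P"
proof
  fix s assume "s \<in> I \<cdot>\<^bsub>R\<^esub> J"
  then show "s \<in> P"
    by induction (auto intro: assms(2) additive_subgroup.a_closed[OF assms(1)])
qed

context ring
begin

lemma ideal_imp_right_ideal: "ideal I R \<Longrightarrow> right_ideal I R"
  by (simp add: ideal_def ideal_axioms_def right_ideal_def right_ideal_axioms_def)

text \<open>Needed because the Artin-Rees property of a second ideal \<open>J\<close> is applied to
  the right ideal \<open>K \<cdot> I\<close> instead of \<open>K\<close>. Negation is absorbed by
  the left factor, multiplication from the right by the right factor.\<close>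

lemma right_ideal_prod:
  assumes K: "right_ideal K R" and I: "right_ideal I R"
  shows "right_ideal (K \<cdot> I) R"
proof -
  interpret K: right_ideal K R by fact
  interpret I: right_ideal I R by fact
  have carr: "s \<in> carrier R" if "s \<in> K \<cdot> I" for s
    using that by induction auto
  have neg: "\<ominus> s \<in> K \<cdot> I" if "s \<in> K \<cdot> I" for s
    using that
  proof induction
    case (prod k i)
    then have "\<ominus> (k \<otimes> i) = (\<ominus> k) \<otimes> i"
      by (simp add: l_minus)
    with prod show ?case
      by (simp add: ideal_prod.prod)
  next
    case (sum s t)
    then have "\<ominus> (s \<oplus> t) = \<ominus> s \<oplus> \<ominus> t"
      using carr by (simp add: minus_add)
    with sum show ?case
      by (simp add: ideal_prod.sum)
  qed
  \<comment> \<open>The inductive set has no empty sum, so zero has to arise as the product of two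
    zeros.\<close>
  have zero: "\<zero> \<in> K \<cdot> I"
    using ideal_prod.prod[of \<zero> K \<zero> I R] by simp
  have "additive_subgroup (K \<cdot> I) R"
    by (intro additive_subgroupI add.subgroupI)
      (use carr neg zero in \<open>auto simp: ideal_prod.sum a_inv_def[symmetric]\<close>)
  moreover have "s \<otimes> x \<in> K \<cdot> I" if "s \<in> K \<cdot> I" and x: "x \<in> carrier R" for s x
    using that(1)
  proof induction
    case (prod k i)
    then have "k \<otimes> i \<otimes> x = k \<otimes> (i \<otimes> x)"
      using x by (simp add: m_assoc)
    with prod show ?case
      using x by (simp add: ideal_prod.prod I.K_r_closed)
  next
    case (sum s t)
    then show ?case
      using x carr by (simp add: l_distr ideal_prod.sum)
  qed
  ultimately show ?thesis
    by (simp add: right_ideal_def right_ideal_axioms_def ring_axioms)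
qed

text \<open>A sum of terms \<open>k \<otimes> i\<close>, multiplied by \<open>j\<close>, expands
  into a sum of terms \<open>k \<otimes> (i \<otimes> j)\<close>. This is an argument about
  elements, so it covers a \<open>K\<close> that is merely a right ideal.\<close>

lemma ideal_prod_assoc_subset:
  assumes "K \<subseteq> carrier R" "I \<subseteq> carrier R" "J \<subseteq> carrier R"
  shows "(K \<cdot> I) \<cdot> J \<subseteq> K \<cdot> (I \<cdot> J)"
proof
  have carr: "s \<in> carrier R" if "s \<in> K \<cdot> I" for s
    using that assms by induction auto
  have step: "s \<otimes> j \<in> K \<cdot> (I \<cdot> J)" if "s \<in> K \<cdot> I" and j: "j \<in> J" for s j
    using that(1)
  proof induction
    case (prod k i)
    then have "k \<otimes> i \<otimes> j = k \<otimes> (i \<otimes> j)"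
      using assms j by (intro m_assoc) auto
    with prod j show ?case
      by (simp add: ideal_prod.prod)
  next
    case (sum s t)
    then show ?case
      using carr j assms by (simp add: l_distr ideal_prod.sum subset_iff)
  qed
  fix s assume "s \<in> (K \<cdot> I) \<cdot> J"
  then show "s \<in> K \<cdot> (I \<cdot> J)"
    by induction (auto intro: step ideal_prod.sum)
qed

lemma ideal_prod_carrier_left:
  assumes "ideal I R"
  shows "carrier R \<cdot> I = I"
proof
  show "carrier R \<cdot> I \<subseteq> I"
    using ideal_prod_inter[OF oneideal assms] by blast
  show "I \<subseteq> carrier R \<cdot> I"
    using ideal_prod.prod[OF one_closed] ideal.Icarr[OF assms] by (metis l_one subsetI)
qed

text \<open>Makes the general power laws of monoids available for ideals: closure under powers, and
  iterated powers.\<close>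

lemma ideals_set_monoid: "monoid (ideals_set R)"
  by (rule monoidI)
    (auto simp: ideals_set_def ideal_prod_is_ideal oneideal ideal_prod_assoc
      ideal_prod_one ideal_prod_carrier_left)

lemma ideal_pow_Suc: "I [^]\<^bsub>ideals_set R\<^esub> Suc n = (I [^]\<^bsub>ideals_set R\<^esub> n) \<cdot> I"
  by (simp add: nat_pow_def) (simp add: ideals_set_def)

lemma ideal_pow_mono:
  assumes "I \<subseteq> J"
  shows "I [^]\<^bsub>ideals_set R\<^esub> (n::nat) \<subseteq> J [^]\<^bsub>ideals_set R\<^esub> n"
proof (induction n)
  case 0
  show ?case by (simp add: nat_pow_def)
next
  case (Suc n)
  then show ?case
    unfolding ideal_pow_Suc using assms by (intro ideal_prod_mono)
qed

lemma ideal_pow_ideal: "ideal I R \<Longrightarrow> ideal (I [^]\<^bsub>ideals_set R\<^esub> (n::nat)) R"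
  using monoid.nat_pow_closed[OF ideals_set_monoid, of I n]
  by (simp add: ideals_set_def)

text \<open>A further factor \<open>I\<close> only shrinks the power, since a product of two ideals
  lies in each of them. Thus an exponent that works for one ideal can be raised to a common
  maximum.\<close>

lemma ideal_pow_antimono:
  assumes "ideal I R" and "m \<le> n"
  shows "I [^]\<^bsub>ideals_set R\<^esub> n \<subseteq> I [^]\<^bsub>ideals_set R\<^esub> (m::nat)"
  using assms(2)
proof (induction n rule: dec_induct)
  case (step n)
  then show ?case
    unfolding ideal_pow_Suc
    using ideal_prod_inter[OF ideal_pow_ideal assms(1)] assms(1) by blast
qed simp

lemma ideal_pow_double:
  assumes "ideal I R"
  shows "I [^]\<^bsub>ideals_set R\<^esub> (2 * n) = (I \<cdot> I) [^]\<^bsub>ideals_set R\<^esub> (n::nat)"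
proof -
  interpret M: monoid "ideals_set R" by (rule ideals_set_monoid)
  have I: "I \<in> carrier (ideals_set R)"
    using assms by (simp add: ideals_set_def)
  have "I [^]\<^bsub>ideals_set R\<^esub> (2::nat) = I \<cdot> I"
    using I by (simp add: numeral_2_eq_2 ideal_pow_Suc) (simp add: ideals_set_def ideal_prod_carrier_left)
  then show ?thesis
    using M.nat_pow_pow[OF I, of 2 n] by simp
qed

section \<open>The Artin-Rees property\<close>

lemma right_artin_rees_property_carrier: "right_artin_rees_property R (carrier R)"
  unfolding right_artin_rees_property_def
proof (intro allI impI exI conjI)
  fix K assume "right_ideal K R"
  then interpret K: right_ideal K R .
  have "K \<subseteq> K \<cdot> carrier R"
    \<comment> \<open>Every \<open>k\<close> is the product of \<open>k\<close> and the unit; with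
      this inclusion the exponent 1 suffices.\<close>
    using ideal_prod.prod[OF _ one_closed] K.a_Hcarr by (metis r_one subsetI)
  then show "K \<inter> (carrier R [^]\<^bsub>ideals_set R\<^esub> (1::nat)) \<subseteq> K \<cdot> carrier R"
    by blast
qed simp

lemma right_artin_rees_property_prod:
  assumes I: "ideal I R" "right_artin_rees_property R I"
    and J: "ideal J R" "right_artin_rees_property R J"
  shows "right_artin_rees_property R (I \<cdot> J)"
  unfolding right_artin_rees_property_def
proof (intro allI impI)
  fix K assume K: "right_ideal K R"
  let ?p = "\<lambda>A k::nat. A [^]\<^bsub>ideals_set R\<^esub> k"
  obtain n :: nat where n: "n > 0" "K \<inter> ?p I n \<subseteq> K \<cdot> I"
    using I(2) K unfolding right_artin_rees_property_def by blast
  have "right_ideal (K \<cdot> I) R"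
    by (rule right_ideal_prod[OF K ideal_imp_right_ideal[OF I(1)]])
  then obtain m :: nat where m: "(K \<cdot> I) \<inter> ?p J m \<subseteq> (K \<cdot> I) \<cdot> J"
    using J(2) unfolding right_artin_rees_property_def by blast
  have "I \<cdot> J \<subseteq> I" "I \<cdot> J \<subseteq> J"
    using ideal_prod_inter[OF I(1) J(1)] by auto
  then have "?p (I \<cdot> J) (max n m) \<subseteq> ?p I (max n m)" "?p (I \<cdot> J) (max n m) \<subseteq> ?p J (max n m)"
    by (simp_all add: ideal_pow_mono)
  moreover have "?p I (max n m) \<subseteq> ?p I n" "?p J (max n m) \<subseteq> ?p J m"
    by (rule ideal_pow_antimono[OF I(1)] ideal_pow_antimono[OF J(1)], simp)+
  moreover have "K \<subseteq> carrier R" "I \<subseteq> carrier R" "J \<subseteq> carrier R"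
    using K I(1) J(1) by (simp_all add: additive_subgroup.a_subset right_ideal_def ideal_def)
  then have "(K \<cdot> I) \<cdot> J \<subseteq> K \<cdot> (I \<cdot> J)"
    by (rule ideal_prod_assoc_subset)
  \<comment> \<open>An element of the left side lies in \<open>K\<close> and in
    \<open>?p I n\<close>, hence in \<open>K \<cdot> I\<close>; it also lies in
    \<open>?p J m\<close>, hence in \<open>(K \<cdot> I) \<cdot> J\<close>.\<close>
  ultimately have "K \<inter> ?p (I \<cdot> J) (max n m) \<subseteq> K \<cdot> (I \<cdot> J)"
    using n m by blast
  then show "\<exists>k::nat. k > 0 \<and> K \<inter> ?p (I \<cdot> J) k \<subseteq> K \<cdot> (I \<cdot> J)"
    using n(1) by (intro exI[of _ "max n m"]) simp
qed

lemma right_artin_rees_property_square_between: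
  assumes J: "right_artin_rees_property R J" and I: "ideal I R"
    and "I \<cdot> I \<subseteq> J" "J \<subseteq> I"
  shows "right_artin_rees_property R I"
  unfolding right_artin_rees_property_def
proof (intro allI impI)
  fix K assume "right_ideal K R"
  then obtain n :: nat where n: "n > 0" "K \<inter> (J [^]\<^bsub>ideals_set R\<^esub> n) \<subseteq> K \<cdot> J"
    using J unfolding right_artin_rees_property_def by blast
  have "I [^]\<^bsub>ideals_set R\<^esub> (2 * n) \<subseteq> J [^]\<^bsub>ideals_set R\<^esub> n"
    using ideal_pow_mono[OF assms(3)] ideal_pow_double[OF I] by simp
  moreover have "K \<cdot> J \<subseteq> K \<cdot> I"
    by (simp add: ideal_prod_mono assms(4))
  ultimately show "\<exists>k::nat. k > 0 \<and> K \<inter> (I [^]\<^bsub>ideals_set R\<^esub> k) \<subseteq> K \<cdot> I"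
    using n by (intro exI[of _ "2 * n"]) auto
qed

lemma satisfies_P2_right_artin_rees:
  "satisfies_P2 R {I. ideal I R \<and> right_artin_rees_property R I}"
  unfolding satisfies_P2_def
proof (intro conjI ballI allI impI)
  show "carrier R \<in> {I. ideal I R \<and> right_artin_rees_property R I}"
    by (simp add: oneideal right_artin_rees_property_carrier)
next
  fix I J
  assume "I \<in> {I. ideal I R \<and> right_artin_rees_property R I}"
    "J \<in> {I. ideal I R \<and> right_artin_rees_property R I}"
  then show "I \<cdot> J \<in> {I. ideal I R \<and> right_artin_rees_property R I}"
    by (simp add: ideal_prod_is_ideal right_artin_rees_property_prod)
next
  fix J I
  assume "J \<in> {I. ideal I R \<and> right_artin_rees_property R I}"
    "ideal I R \<and> I \<cdot> I \<subseteq> J \<and> J \<subseteq> I"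
  then show "I \<in> {I. ideal I R \<and> right_artin_rees_property R I}"
    using right_artin_rees_property_square_between[of J I] by simp
qed simp

section \<open>Maximal ideals outside a family with (P2)\<close>

lemma satisfies_P2_prod:
  "\<lbrakk>satisfies_P2 R F; I \<in> F; J \<in> F\<rbrakk> \<Longrightarrow> I \<cdot> J \<in> F"
  unfolding satisfies_P2_def by (elim conjE) (drule (1) bspec)+

lemma satisfies_P2_square_between:
  "\<lbrakk>satisfies_P2 R F; J \<in> F; ideal I R; I \<cdot> I \<subseteq> J; J \<subseteq> I\<rbrakk> \<Longrightarrow> I \<in> F"
  unfolding satisfies_P2_def by blast

text \<open>The sum of two ideals is the ideal generated by their union.\<close>

lemma subset_set_add:
  assumes "ideal I R" "ideal J R"
  shows "I \<subseteq> I <+>\<^bsub>R\<^esub> J" "J \<subseteq> I <+>\<^bsub>R\<^esub> J"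
proof -
  have "I \<union> J \<subseteq> Idl (I \<union> J)"
    using assms ideal.Icarr by (intro genideal_self) auto
  then show "I \<subseteq> I <+>\<^bsub>R\<^esub> J" "J \<subseteq> I <+>\<^bsub>R\<^esub> J"
    using union_genideal[OF assms] by auto
qed

text \<open>In the expansion of \<open>(a \<oplus> p) \<otimes> (b \<oplus> q)\<close> the term
  \<open>a \<otimes> b\<close> lies in \<open>A \<cdot> B\<close>, and every other term has a factor
  in the two-sided ideal \<open>P\<close>.\<close>

lemma ideal_prod_add_subset:
  assumes A: "ideal A R" and B: "ideal B R" and P: "ideal P R" and AB: "A \<cdot> B \<subseteq> P"
  shows "(A <+>\<^bsub>R\<^esub> P) \<cdot> (B <+>\<^bsub>R\<^esub> P) \<subseteq> P"
proof (rule ideal_prod_least)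
  interpret A: ideal A R by fact
  interpret B: ideal B R by fact
  interpret P: ideal P R by fact
  show "additive_subgroup P R" ..
  fix x y assume "x \<in> A <+>\<^bsub>R\<^esub> P" "y \<in> B <+>\<^bsub>R\<^esub> P"
  then obtain a p b q where x: "x = a \<oplus> p" "a \<in> A" "p \<in> P" and y: "y = b \<oplus> q" "b \<in> B" "q \<in> P"
    by (auto simp: set_add_def')
  have "a \<otimes> b \<in> P"
    using AB x(2) y(2) by (auto intro: ideal_prod.prod)
  moreover have "a \<otimes> q \<in> P" "p \<otimes> (b \<oplus> q) \<in> P"
    using x y by (auto intro: P.I_l_closed P.I_r_closed)
  moreover have "x \<otimes> y = (a \<otimes> b \<oplus> a \<otimes> q) \<oplus> p \<otimes> (b \<oplus> q)"
    using x y by (simp add: l_distr r_distr a_ac)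
  ultimately show "x \<otimes> y \<in> P"
    by simp
qed

lemma satisfies_P2_maximal_prime:
  assumes F: "satisfies_P2 R F"
    and P: "ideal P R" "P \<notin> F" and max: "\<And>J. \<lbrakk>ideal J R; P \<subset> J\<rbrakk> \<Longrightarrow> J \<in> F"
  shows "nc_prime_ideal P R"
proof (intro nc_prime_ideal.intro nc_prime_ideal_axioms.intro)
  show "ideal P R" by fact
  show "P \<noteq> carrier R"
    \<comment> \<open>The whole ring belongs to \<open>F\<close>, while \<open>P\<close> does
      not.\<close>
    using F P(2) unfolding satisfies_P2_def by blast
  fix A B assume A: "ideal A R" and B: "ideal B R" and AB: "A \<cdot> B \<subseteq> P"
  show "A \<subseteq> P \<or> B \<subseteq> P"
  proof (rule ccontr)
    assume "\<not> ?thesis"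
    \<comment> \<open>Equality would put the summand \<open>A\<close> or \<open>B\<close> inside
      \<open>P\<close>.\<close>
    then have "P \<subset> A <+>\<^bsub>R\<^esub> P" "P \<subset> B <+>\<^bsub>R\<^esub> P"
      using subset_set_add[OF A P(1)] subset_set_add[OF B P(1)] by auto
    then have "A <+>\<^bsub>R\<^esub> P \<in> F" "B <+>\<^bsub>R\<^esub> P \<in> F"
      using add_ideals A B P(1) by (simp_all add: max)
    then have "(A <+>\<^bsub>R\<^esub> P) \<cdot> (B <+>\<^bsub>R\<^esub> P) \<in> F"
      by (rule satisfies_P2_prod[OF F])
    moreover have "P \<cdot> P \<subseteq> (A <+>\<^bsub>R\<^esub> P) \<cdot> (B <+>\<^bsub>R\<^esub> P)"
      by (rule ideal_prod_mono[OF subset_set_add(2)[OF A P(1)] subset_set_add(2)[OF B P(1)]])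
    moreover have "(A <+>\<^bsub>R\<^esub> P) \<cdot> (B <+>\<^bsub>R\<^esub> P) \<subseteq> P"
      by (rule ideal_prod_add_subset[OF A B P(1) AB])
    ultimately have "P \<in> F"
      using satisfies_P2_square_between[OF F _ P(1)] by blast
    then show False
      using P(2) by contradiction
  qed
qed

end

text \<open>If every ideal with \<open>Q\<close> were strictly contained in another one, dependent
  choice would build a strictly ascending sequence of ideals. It is applied with \<open>Q\<close> as
  the failure of the Artin-Rees property.\<close>

lemma acc_on_ideals_maximal:
  fixes R :: "('a, 'b) ring_scheme"
  assumes acc: "acc_on_ideals R" and I: "ideal I R" "Q I"
  obtains P where "ideal P R" "Q P" "\<And>J. \<lbrakk>ideal J R; P \<subset> J\<rbrakk> \<Longrightarrow> \<not> Q J"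
proof (rule ccontr)
  assume "\<not> thesis"
  with that have "\<exists>J. (ideal J R \<and> Q J) \<and> P \<subset> J" if "ideal P R \<and> Q P" for P
    using that by blast
  then have "\<exists>C. \<forall>n::nat. (ideal (C n) R \<and> Q (C n)) \<and> C n \<subset> C (Suc n)"
    using I by (intro dependent_nat_choice[of "\<lambda>_ P. ideal P R \<and> Q P" "\<lambda>_ P J. P \<subset> J"]) auto
  then obtain C :: "nat \<Rightarrow> 'a set"
    where C: "\<And>n. ideal (C n) R" "\<And>n. C n \<subset> C (Suc n)"
    by blast
  then have "(\<forall>n. ideal (C n) R) \<and> (\<forall>n. C n \<subseteq> C (Suc n))"
    by blast
  then obtain N where "\<forall>n\<ge>N. C n = C N"
    using acc unfolding acc_on_ideals_def by blast
  then have "C (Suc N) = C N"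
    by (metis le_SucI order_refl)
  \<comment> \<open>The chain is constant from \<open>N\<close> on, yet its next step is
    strict.\<close>
  with C(2)[of N] show False
    by simp
qed

theorem proposition3p10:
  fixes R :: "('a, 'b) ring_scheme"
  assumes "ring R"
  shows "satisfies_P2 R {I. ideal I R \<and> right_artin_rees_property R I}
    \<and> (\<forall>P. maximal_without_right_artin_rees R P \<longrightarrow> nc_prime_ideal P R)
    \<and> (acc_on_ideals R \<longrightarrow>
        (right_artin_rees_ring R \<longleftrightarrow>
          (\<forall>P. nc_prime_ideal P R \<longrightarrow> right_artin_rees_property R P)))"
proof (intro conjI impI allI)
  interpret ring R by fact
  show P2: "satisfies_P2 R {I. ideal I R \<and> right_artin_rees_property R I}"
    by (rule satisfies_P2_right_artin_rees)
  show prime: "nc_prime_ideal P R" if "maximal_without_right_artin_rees R P" for P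
    using that satisfies_P2_maximal_prime[OF P2]
    unfolding maximal_without_right_artin_rees_def by blast
  assume acc: "acc_on_ideals R"
  show "right_artin_rees_ring R \<longleftrightarrow>
    (\<forall>P. nc_prime_ideal P R \<longrightarrow> right_artin_rees_property R P)"
  proof
    assume "right_artin_rees_ring R"
    then show "\<forall>P. nc_prime_ideal P R \<longrightarrow> right_artin_rees_property R P"
      unfolding right_artin_rees_ring_def nc_prime_ideal_def by blast
  next
    assume primes: "\<forall>P. nc_prime_ideal P R \<longrightarrow> right_artin_rees_property R P"
    have "right_artin_rees_property R I" if "ideal I R" for I
    proof (rule ccontr)
      assume "\<not> ?thesis"
      \<comment> \<open>One failing ideal yields a maximal failing one; that ideal is prime by the
        second claim, so it has the property by assumption.\<close>
      with acc that obtain P where "maximal_without_right_artin_rees R P"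
        using acc_on_ideals_maximal[of R I "\<lambda>J. \<not> right_artin_rees_property R J"]
        unfolding maximal_without_right_artin_rees_def by metis
      then show False
        using prime primes unfolding maximal_without_right_artin_rees_def by blast
    qed
    then show "right_artin_rees_ring R"
      using assms unfolding right_artin_rees_ring_def by blast
  qed
qed

end
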